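(* Let $(X,d)$ be a u.l.f. metric space, $h\colon X\to\mathbb{R}$ a coarse map, and $\beta\ge 0$. There are strongly continuous $(\sigma_h,\beta)$-KMS states on $\mathrm{C}^*_u(X)$ if and only if $Z(\beta):=\sum_{x\in X}e^{-\beta h(x)}<\infty$. Moreover, a function $\varphi\colon\mathrm{C}^*_u(X)\to\mathbb{C}$ is a strongly continuous $(\sigma_h,\beta)$-KMS state on $\mathrm{C}^*_u(X)$ if and only if $$\varphi(a)=\frac{1}{Z(\beta)}\sum_{x\in X}a_{x,x}e^{-\beta h(x)}$$ for all $a=[a_{x,y}]\in\mathrm{C}^*_u(X)$. In particular, whenever they exist, strongly continuous $(\sigma_h,\beta)$-KMS states are unique.
   Context: A metric space is u.l.f. if for every $r>0$ the cardinalities of its balls of radius $r$ are uniformly bounded. With $(\delta_x)$ the canonical basis of $\ell_2(X)$ and $a_{x,y}=\langle a\delta_y,\delta_x\rangle$, $\mathrm{C}^*_u(X)$ is the norm closure of the $^*$-algebra of operators $a$ with $\sup\{d(x,y):a_{x,y}\neq0\}<\infty$. $h$ is coarse if for each $r>0$ there is $s>0$ with $d(x,y)<r\Rightarrow|h(x)-h(y)|<s$. $\sigma_{h,t}(a)=e^{it\bar h}ae^{-it\bar h}$ where $e^{it\bar h}\delta_x=e^{ith(x)}\delta_x$; this is a flow on $\mathrm{C}^*_u(X)$. $b$ is analytic if $t\mapsto\sigma_{h,t}(b)$ extends to an entire map $z\mapsto\sigma_{h,z}(b)$; a state $\varphi$ is $(\sigma_h,\beta)$-KMS if $\varphi(a\sigma_{h,i\beta}(b))=\varphi(ba)$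 for all $a$ and all analytic $b$. A state is strongly continuous if it is continuous on bounded subsets of $\mathrm{C}^*_u(X)$ with respect to the strong operator topology. *)

theory Defs
  imports "HOL-Analysis.Analysis"
begin

text \<open>Operators on ell2(X) are represented by their matrices
  a x y = <a delta_y, delta_x>.\<close>

type_synonym 'a mat = "'a \<Rightarrow> 'a \<Rightarrow> complex"

definition mat_add :: "'a mat \<Rightarrow> 'a mat \<Rightarrow> 'a mat" where
  "mat_add a b = (\<lambda>x y. a x y + b x y)"

definition mat_sub :: "'a mat \<Rightarrow> 'a mat \<Rightarrow> 'a mat" where
  "mat_sub a b = (\<lambda>x y. a x y - b x y)"

definition ulf :: "'a::metric_space itself \<Rightarrow> bool" where
  "ulf _ \<longleftrightarrow> (\<forall>r>0. \<exists>N::nat. \<forall>x::'a. finite (ball x r) \<and> card (ball x r) \<le> N)"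

definition coarse :: "('a::metric_space \<Rightarrow> real) \<Rightarrow> bool" where
  "coarse h \<longleftrightarrow> (\<forall>r>0. \<exists>s>0. \<forall>x y. dist x y < r \<longrightarrow> \<bar>h x - h y\<bar> < s)"

definition ell2 :: "('a \<Rightarrow> complex) \<Rightarrow> bool" where
  "ell2 f \<longleftrightarrow> (\<lambda>x. (cmod (f x))^2) summable_on UNIV"

definition ell2_norm :: "('a \<Rightarrow> complex) \<Rightarrow> real" where
  "ell2_norm f = sqrt (infsum (\<lambda>x. (cmod (f x))^2) UNIV)"

definition mat_app :: "'a mat \<Rightarrow> ('a \<Rightarrow> complex) \<Rightarrow> ('a \<Rightarrow> complex)" where
  "mat_app a f = (\<lambda>x. infsum (\<lambda>y. a x y * f y) UNIV)"

definition bounded_mat :: "'a mat \<Rightarrow> bool" where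
  "bounded_mat a \<longleftrightarrow> (\<exists>C. \<forall>f. ell2 f \<longrightarrow>
      (\<forall>x. (\<lambda>y. cmod (a x y * f y)) summable_on UNIV) \<and>
      ell2 (mat_app a f) \<and> ell2_norm (mat_app a f) \<le> C * ell2_norm f)"

definition opnorm :: "'a mat \<Rightarrow> real" where
  "opnorm a = Inf {C. C \<ge> 0 \<and> (\<forall>f. ell2 f \<longrightarrow> ell2_norm (mat_app a f) \<le> C * ell2_norm f)}"

definition finite_prop :: "('a::metric_space) mat \<Rightarrow> bool" where
  "finite_prop a \<longleftrightarrow> (\<exists>R. \<forall>x y. a x y \<noteq> 0 \<longrightarrow> dist x y \<le> R)"

definition uroe :: "('a::metric_space) mat set" where
  "uroe = {a. bounded_mat a \<and>
     (\<forall>e>0. \<exists>b. bounded_mat b \<and> finite_prop b \<and> opnorm (mat_sub a b) < e)}"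

definition mat_mult :: "'a mat \<Rightarrow> 'a mat \<Rightarrow> 'a mat" where
  "mat_mult a b = (\<lambda>x y. infsum (\<lambda>z. a x z * b z y) UNIV)"

definition mat_adj :: "'a mat \<Rightarrow> 'a mat" where
  "mat_adj a = (\<lambda>x y. cnj (a y x))"

definition mat_smul :: "complex \<Rightarrow> 'a mat \<Rightarrow> 'a mat" where
  "mat_smul c a = (\<lambda>x y. c * a x y)"

definition mat_id :: "'a mat" where
  "mat_id = (\<lambda>x y. if x = y then 1 else 0)"

text \<open>The flow sigma_{h,t}(a) = e^{it h} a e^{-it h}.\<close>
definition sigma :: "('a \<Rightarrow> real) \<Rightarrow> real \<Rightarrow> 'a mat \<Rightarrow> 'a mat" where
  "sigma h t a = (\<lambda>x y. exp (\<i> * of_real t * of_real (h x)) * a x y * exp (- \<i> * of_real t * of_real (h y)))"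

definition op_entire :: "(complex \<Rightarrow> ('a::metric_space) mat) \<Rightarrow> bool" where
  "op_entire F \<longleftrightarrow> (\<forall>z. F z \<in> uroe) \<and>
     (\<forall>z. \<exists>D. bounded_mat D \<and>
        ((\<lambda>w. opnorm (mat_sub (mat_smul (inverse (w - z)) (mat_sub (F w) (F z))) D)) \<longlongrightarrow> 0) (at z))"

text \<open>F is the entire extension of t \<mapsto> sigma_{h,t}(b); b is analytic iff such F exists,
  and then sigma_{h,z}(b) = F z.\<close>
definition analytic_ext :: "('a::metric_space \<Rightarrow> real) \<Rightarrow> 'a mat \<Rightarrow> (complex \<Rightarrow> 'a mat) \<Rightarrow> bool" where
  "analytic_ext h b F \<longleftrightarrow> op_entire F \<and> (\<forall>t::real. F (of_real t) = sigma h t b)"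

definition is_state :: "(('a::metric_space) mat \<Rightarrow> complex) \<Rightarrow> bool" where
  "is_state \<phi> \<longleftrightarrow>
     (\<forall>a\<in>uroe. \<forall>b\<in>uroe. \<phi> (mat_add a b) = \<phi> a + \<phi> b) \<and>
     (\<forall>a\<in>uroe. \<forall>c. \<phi> (mat_smul c a) = c * \<phi> a) \<and>
     (\<forall>a\<in>uroe. Im (\<phi> (mat_mult (mat_adj a) a)) = 0 \<and> Re (\<phi> (mat_mult (mat_adj a) a)) \<ge> 0) \<and>
     \<phi> mat_id = 1"

definition is_KMS :: "('a::metric_space \<Rightarrow> real) \<Rightarrow> real \<Rightarrow> ('a mat \<Rightarrow> complex) \<Rightarrow> bool" where
  "is_KMS h \<beta> \<phi> \<longleftrightarrow> is_state \<phi> \<and>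
     (\<forall>a\<in>uroe. \<forall>b F. b \<in> uroe \<longrightarrow> analytic_ext h b F \<longrightarrow>
        \<phi> (mat_mult a (F (\<i> * of_real \<beta>))) = \<phi> (mat_mult b a))"

definition strongly_continuous :: "(('a::metric_space) mat \<Rightarrow> complex) \<Rightarrow> bool" where
  "strongly_continuous \<phi> \<longleftrightarrow>
     (\<forall>B. B \<subseteq> uroe \<longrightarrow> (\<exists>M. \<forall>b\<in>B. opnorm b \<le> M) \<longrightarrow>
        (\<forall>a\<in>B. \<forall>e>0. \<exists>V \<delta>. finite V \<and> (\<forall>\<xi>\<in>V. ell2 \<xi>) \<and> \<delta> > 0 \<and>
           (\<forall>b\<in>B. (\<forall>\<xi>\<in>V. ell2_norm (mat_app (mat_sub b a) \<xi>) < \<delta>) \<longrightarrow> cmod (\<phi> b - \<phi> a) < e)))"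

end

theory Submission
  imports Defs "HOL-Complex_Analysis.Complex_Analysis"
begin

text \<open>
  Matrix units are analytic, so the KMS condition can be tested against them: the pair
  \<open>e\<^sub>y\<^sub>x\<close>, \<open>e\<^sub>x\<^sub>y\<close> forces \<open>\<phi>(e\<^sub>x\<^sub>x)\<close> to be proportional to \<open>exp (- \<beta> h(x))\<close>, and pairing
  \<open>e\<^sub>x\<^sub>x\<close> with \<open>e\<^sub>x\<^sub>x a\<close> gives \<open>\<phi>(e\<^sub>x\<^sub>x a) = a\<^sub>x\<^sub>x \<phi>(e\<^sub>x\<^sub>x)\<close>. For finite \<open>A\<close> the row truncations of \<open>a\<close> to
  \<open>A\<close> are bounded by the norm of \<open>a\<close> and converge strongly to \<open>a\<close>, hence strong continuity turns these
  identities into the sum formula for \<open>\<phi>(a)\<close>; the case \<open>a = 1\<close> gives \<open>Z(\<beta>) < \<infinity>\<close>.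
  Conversely, by the identity theorem the matrix entries of an analytic extension are
  \<open>exp (\<i> z (h(x) - h(y))) b\<^sub>x\<^sub>y\<close>, and the KMS condition for the Gibbs functional becomes the
  interchange of two absolutely convergent sums.
\<close>

section \<open>Square-summable functions and bounded matrices\<close>

abbreviation l2_on :: "('a \<Rightarrow> complex) \<Rightarrow> 'a set \<Rightarrow> real" where
  "l2_on f A \<equiv> L2_set (\<lambda>x. cmod (f x)) A"

lemma l2_on_subset: "finite B \<Longrightarrow> A \<subseteq> B \<Longrightarrow> l2_on f A \<le> l2_on f B"
  unfolding L2_set_def by (simp add: sum_mono2)

lemma Cauchy_Schwarz_on: "(\<Sum>x\<in>A. cmod (f x * g x)) \<le> l2_on f A * l2_on g A"
  using L2_set_mult_ineq[of "\<lambda>x. cmod (f x)" "\<lambda>x. cmod (g x)" A] by (simp add: norm_mult)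

lemma norm_sum_Cauchy_Schwarz: "cmod (\<Sum>x\<in>A. f x * g x) \<le> l2_on f A * l2_on g A"
  by (rule order_trans[OF norm_sum Cauchy_Schwarz_on])

text \<open>Testing against the conjugate of \<open>f\<close>, whose norm on \<open>A\<close> is the
  same, bounds the square of the norm by \<open>C\<close> times the norm; one factor then cancels
  unless it is zero.\<close>

lemma l2_on_dual:
  assumes "\<And>g. cmod (\<Sum>x\<in>A. g x * f x) \<le> C * l2_on g A" and "C \<ge> 0"
  shows "l2_on f A \<le> C"
proof -
  have "(l2_on f A)\<^sup>2 = (\<Sum>x\<in>A. (cmod (f x))\<^sup>2)"
    unfolding L2_set_def by (simp add: sum_nonneg)
  also have "complex_of_real \<dots> = (\<Sum>x\<in>A. cnj (f x) * f x)"
    by (simp add: mult.commute[of "cnj _"] flip: complex_norm_square)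
  hence "(\<Sum>x\<in>A. (cmod (f x))\<^sup>2) \<le> cmod (\<Sum>x\<in>A. cnj (f x) * f x)"
    by (metis complex_Re_le_cmod Re_complex_of_real)
  also have "\<dots> \<le> C * l2_on (\<lambda>x. cnj (f x)) A" by (rule assms)
  finally have "l2_on f A * l2_on f A \<le> C * l2_on f A" by (simp add: power2_eq_square)
  thus ?thesis using \<open>C \<ge> 0\<close>
    by (cases "l2_on f A = 0") (auto simp: less_le)
qed

section \<open>The ell2 norm through finite sections\<close>

lemma ell2_norm_nonneg [simp]: "ell2_norm f \<ge> 0"
  unfolding ell2_norm_def by (simp add: infsum_nonneg)

lemma l2_on_le_ell2_norm:
  assumes "ell2 f" "finite A" shows "l2_on f A \<le> ell2_norm f"
  unfolding L2_set_def ell2_norm_def using assms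
  by (auto simp: ell2_def intro!: finite_sum_le_infsum)

lemma ell2I:
  assumes "\<And>A. finite A \<Longrightarrow> l2_on f A \<le> C"
  shows "ell2 f" and "ell2_norm f \<le> C"
proof -
  \<comment> \<open>The empty section supplies the sign of \<open>C\<close>, which the comparison of
    squares needs.\<close>
  have C: "C \<ge> 0" using assms[of "{}"] by simp
  have le: "(\<Sum>x\<in>A. (cmod (f x))\<^sup>2) \<le> C\<^sup>2" if "finite A" for A
    using assms[OF that] C unfolding L2_set_def by (simp add: sqrt_le_D)
  show 1: "ell2 f" unfolding ell2_def
    by (rule nonneg_bdd_above_summable_on) (auto intro!: bdd_aboveI2 le)
  have "infsum (\<lambda>x. (cmod (f x))\<^sup>2) UNIV \<le> C\<^sup>2"
    using 1 le by (intro infsum_le_finite_sums) (auto simp: ell2_def)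
  thus "ell2_norm f \<le> C" unfolding ell2_norm_def using C by (simp add: real_le_lsqrt)
qed

lemma ell2_finite_support:
  assumes "finite A" "\<And>x. x \<notin> A \<Longrightarrow> f x = 0"
  shows "ell2 f" and "ell2_norm f = l2_on f A"
proof -
  have "((\<lambda>x. (cmod (f x))\<^sup>2) has_sum (\<Sum>x\<in>A. (cmod (f x))\<^sup>2)) UNIV"
    using assms by (intro has_sum_finite_neutralI[of A]) auto
  thus "ell2 f" "ell2_norm f = l2_on f A"
    unfolding ell2_def ell2_norm_def L2_set_def by (auto simp: infsumI summable_on_def)
qed

lemma ell2_Cauchy_Schwarz:
  assumes "ell2 f" "ell2 g"
  shows "(\<lambda>x. cmod (f x * g x)) summable_on UNIV"
    and "(\<Sum>\<^sub>\<infinity>x. cmod (f x * g x)) \<le> ell2_norm f * ell2_norm g"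
proof -
  have le: "(\<Sum>x\<in>A. cmod (f x * g x)) \<le> ell2_norm f * ell2_norm g" if "finite A" for A
    by (rule order_trans[OF Cauchy_Schwarz_on]) (intro mult_mono l2_on_le_ell2_norm assms that; simp)
  show 1: "(\<lambda>x. cmod (f x * g x)) summable_on UNIV"
    by (rule nonneg_bdd_above_summable_on) (auto intro!: bdd_aboveI2 le)
  show "(\<Sum>\<^sub>\<infinity>x. cmod (f x * g x)) \<le> ell2_norm f * ell2_norm g"
    using 1 le by (intro infsum_le_finite_sums) auto
qed

lemma has_sum_finite_sum:
  fixes f :: "'b \<Rightarrow> 'a \<Rightarrow> 'c::{topological_comm_monoid_add}"
  assumes "finite A" "\<And>x. x \<in> A \<Longrightarrow> (f x has_sum s x) B"
  shows "((\<lambda>y. \<Sum>x\<in>A. f x y) has_sum (\<Sum>x\<in>A. s x)) B"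
  using assms by (induction A rule: finite_induct) (auto intro!: has_sum_add)

lemma norm_infsum_le_finite_sums:
  fixes f :: "'a \<Rightarrow> complex"
  assumes "\<And>A. finite A \<Longrightarrow> cmod (sum f A) \<le> B"
  shows "cmod (infsum f UNIV) \<le> B"
proof (cases "f summable_on UNIV")
  case True
  have "\<forall>\<^sub>F A in finite_subsets_at_top UNIV. cmod (sum f A) \<le> B"
    by (rule eventually_finite_subsets_at_top_weakI) (use assms in auto)
  thus ?thesis
    by (rule tendsto_upperbound[OF tendsto_norm[OF infsum_tendsto[OF True]]]) simp
next
  case False
  \<comment> \<open>A family that is not summable has \<open>infsum\<close> equal to 0 by
    convention, and the empty partial sum gives \<open>B \<ge> 0\<close>.\<close>
  thus ?thesis using assms[of "{}"] by (simp add: infsum_not_exists)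
qed

text \<open>The squared norm of the tail is the full sum minus a finite partial sum. This is the
  source of the strong convergence of row truncations later on.\<close>

lemma ell2_tail_tendsto:
  assumes "ell2 u"
  shows "((\<lambda>A. ell2_norm (\<lambda>x. if x \<in> A then 0 else u x)) \<longlongrightarrow> 0) (finite_subsets_at_top UNIV)"
proof -
  let ?w = "\<lambda>x. (cmod (u x))\<^sup>2"
  have s: "?w summable_on UNIV" using assms by (simp add: ell2_def)
  have eq: "ell2_norm (\<lambda>x. if x \<in> A then 0 else u x) = sqrt (infsum ?w UNIV - sum ?w A)"
    if "finite A" for A
  proof -
    have "infsum (\<lambda>x. (cmod (if x \<in> A then 0 else u x))\<^sup>2) UNIV = infsum ?w (UNIV - A)"
      by (rule infsum_cong_neutral) auto
    also have "\<dots> = infsum ?w UNIV - sum ?w A"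
      using s that by (subst infsum_Diff) auto
    finally show ?thesis by (simp add: ell2_norm_def)
  qed
  have "((\<lambda>A. sqrt (infsum ?w UNIV - sum ?w A)) \<longlongrightarrow> sqrt (infsum ?w UNIV - infsum ?w UNIV))
          (finite_subsets_at_top UNIV)"
    by (intro tendsto_intros infsum_tendsto s)
  hence "((\<lambda>A. sqrt (infsum ?w UNIV - sum ?w A)) \<longlongrightarrow> 0) (finite_subsets_at_top UNIV)" by simp
  thus ?thesis
    by (rule Lim_transform_eventually)
      (rule eventually_finite_subsets_at_top_weakI, simp add: eq)
qed

text \<open>Boundedness of a matrix tested on finitely supported vectors only. This form is visibly
  symmetric in rows and columns, and no convergence question arises when manipulating it.\<close>
definition form_bound :: "real \<Rightarrow> 'a mat \<Rightarrow> bool" where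
  "form_bound C a \<longleftrightarrow> (\<forall>A B g f. finite A \<longrightarrow> finite B \<longrightarrow>
     cmod (\<Sum>x\<in>A. \<Sum>y\<in>B. g x * a x y * f y) \<le> C * l2_on g A * l2_on f B)"

lemma form_boundD:
  "form_bound C a \<Longrightarrow> finite A \<Longrightarrow> finite B \<Longrightarrow>
    cmod (\<Sum>x\<in>A. \<Sum>y\<in>B. g x * a x y * f y) \<le> C * l2_on g A * l2_on f B"
  unfolding form_bound_def by blast

lemma form_bound_mono: "form_bound C a \<Longrightarrow> C \<le> D \<Longrightarrow> form_bound D a"
  unfolding form_bound_def by (meson L2_set_nonneg mult_right_mono order_trans)

lemma form_bound_transpose:
  assumes "form_bound C a" shows "form_bound C (\<lambda>x y. a y x)"
  unfolding form_bound_def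
proof (intro allI impI)
  fix A B :: "'a set" and g f :: "'a \<Rightarrow> complex" assume fin: "finite A" "finite B"
  have "(\<Sum>x\<in>A. \<Sum>y\<in>B. g x * a y x * f y) = (\<Sum>y\<in>B. \<Sum>x\<in>A. f y * a y x * g x)"
    by (subst sum.swap) (simp add: mult_ac)
  thus "cmod (\<Sum>x\<in>A. \<Sum>y\<in>B. g x * a y x * f y) \<le> C * l2_on g A * l2_on f B"
    using form_boundD[OF assms fin(2,1), of f g] by (simp add: mult_ac)
qed

lemma form_bound_adj:
  assumes "form_bound C a" shows "form_bound C (mat_adj a)"
  unfolding form_bound_def
proof (intro allI impI)
  fix A B :: "'a set" and g f :: "'a \<Rightarrow> complex" assume "finite A" "finite B"
  have "cmod (\<Sum>x\<in>A. \<Sum>y\<in>B. g x * mat_adj a x y * f y)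
      = cmod (cnj (\<Sum>x\<in>A. \<Sum>y\<in>B. cnj (g x) * a y x * cnj (f y)))"
    by (simp add: mat_adj_def)
  \<comment> \<open>Conjugation moves from the entries onto both test vectors, whose norms it
    preserves, so the transposed form bound applies.\<close>
  also have "\<dots> \<le> C * l2_on (\<lambda>x. cnj (g x)) A * l2_on (\<lambda>y. cnj (f y)) B"
    unfolding complex_mod_cnj
    using form_boundD[OF form_bound_transpose[OF assms] \<open>finite A\<close> \<open>finite B\<close>,
        of "\<lambda>x. cnj (g x)" "\<lambda>y. cnj (f y)"] by simp
  finally show "cmod (\<Sum>x\<in>A. \<Sum>y\<in>B. g x * mat_adj a x y * f y) \<le> C * l2_on g A * l2_on f B"
    by simp
qed

lemma form_bound_add:
  assumes "form_bound C a" "form_bound D b" shows "form_bound (C + D) (mat_add a b)"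
  unfolding form_bound_def
proof (intro allI impI)
  fix A B :: "'a set" and g f :: "'a \<Rightarrow> complex" assume fin: "finite A" "finite B"
  have "(\<Sum>x\<in>A. \<Sum>y\<in>B. g x * mat_add a b x y * f y)
    = (\<Sum>x\<in>A. \<Sum>y\<in>B. g x * a x y * f y) + (\<Sum>x\<in>A. \<Sum>y\<in>B. g x * b x y * f y)"
    by (simp add: mat_add_def sum.distrib distrib_left distrib_right)
  also have "cmod \<dots> \<le> C * l2_on g A * l2_on f B + D * l2_on g A * l2_on f B"
    by (rule order_trans[OF norm_triangle_ineq]) (intro add_mono form_boundD assms fin)
  finally show "cmod (\<Sum>x\<in>A. \<Sum>y\<in>B. g x * mat_add a b x y * f y)
      \<le> (C + D) * l2_on g A * l2_on f B"
    by (simp add: algebra_simps)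
qed

lemma form_bound_smul:
  assumes "form_bound C a" shows "form_bound (cmod c * C) (mat_smul c a)"
  unfolding form_bound_def
proof (intro allI impI)
  fix A B :: "'a set" and g f :: "'a \<Rightarrow> complex" assume fin: "finite A" "finite B"
  have "(\<Sum>x\<in>A. \<Sum>y\<in>B. g x * mat_smul c a x y * f y) = c * (\<Sum>x\<in>A. \<Sum>y\<in>B. g x * a x y * f y)"
    by (simp add: mat_smul_def sum_distrib_left mult_ac)
  also have "cmod \<dots> \<le> cmod c * (C * l2_on g A * l2_on f B)"
    unfolding norm_mult by (intro mult_left_mono form_boundD assms fin) simp
  finally show "cmod (\<Sum>x\<in>A. \<Sum>y\<in>B. g x * mat_smul c a x y * f y)
      \<le> cmod c * C * l2_on g A * l2_on f B"
    by (simp add: mult_ac)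
qed

lemma mat_sub_eq: "mat_sub a b = mat_add a (mat_smul (-1) b)"
  by (simp add: mat_sub_def mat_add_def mat_smul_def)

lemma form_bound_sub:
  "form_bound C a \<Longrightarrow> form_bound D b \<Longrightarrow> form_bound (C + D) (mat_sub a b)"
  unfolding mat_sub_eq using form_bound_add[of C a D "mat_smul (-1) b"] form_bound_smul[of D b "-1"]
  by simp

section \<open>Entries, rows, columns and images under a form bound\<close>

lemma form_bound_entry:
  assumes "form_bound C a" shows "cmod (a x y) \<le> C"
  using form_boundD[OF assms, of "{x}" "{y}" "\<lambda>_. 1" "\<lambda>_. 1"] by simp

lemma form_bound_nonneg: "form_bound C a \<Longrightarrow> C \<ge> 0"
  using form_bound_entry[of C a] norm_ge_zero order_trans by blast

text \<open>With the left test vector concentrated at the single point \<open>x\<close>, the form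
  bound says that row \<open>x\<close> is a functional of norm at most \<open>C\<close>; duality
  turns this into an ell2 bound.\<close>

lemma form_bound_row:
  assumes "form_bound C a" shows "ell2 (a x)" and "ell2_norm (a x) \<le> C"
proof -
  have "l2_on (a x) B \<le> C" if "finite B" for B
  proof (rule l2_on_dual[OF _ form_bound_nonneg[OF assms]])
    fix g show "cmod (\<Sum>y\<in>B. g y * a x y) \<le> C * l2_on g B"
      using form_boundD[OF assms, of "{x}" B "\<lambda>_. 1" g] that by (simp add: mult.commute)
  qed
  thus "ell2 (a x)" "ell2_norm (a x) \<le> C" using ell2I[of "a x" C] by auto
qed

lemma form_bound_col:
  assumes "form_bound C a" shows "ell2 (\<lambda>x. a x y)" and "ell2_norm (\<lambda>x. a x y) \<le> C"
  using form_bound_row[OF form_bound_transpose[OF assms]] by auto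

text \<open>By duality it suffices to pair \<open>mat_app a f\<close> with vectors \<open>g\<close>
  on a finite set \<open>A\<close>. There the sum over \<open>A\<close> may be moved inside the
  infinite sum over \<open>y\<close>, whose finite sections are values of the form.\<close>

lemma form_bound_app:
  assumes "form_bound C a" "ell2 f"
  shows "ell2 (mat_app a f)" and "ell2_norm (mat_app a f) \<le> C * ell2_norm f"
proof -
  have C: "C \<ge> 0" by (rule form_bound_nonneg[OF assms(1)])
  have s: "(\<lambda>y. a x y * f y) summable_on UNIV" for x
    by (rule abs_summable_summable) (rule ell2_Cauchy_Schwarz(1)[OF form_bound_row(1)[OF assms(1)] assms(2)])
  have "l2_on (mat_app a f) A \<le> C * ell2_norm f" if A: "finite A" for A
  proof (rule l2_on_dual)
    fix g
    have "(\<Sum>x\<in>A. g x * mat_app a f x) = (\<Sum>x\<in>A. \<Sum>\<^sub>\<infinity>y. g x * (a x y * f y))"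
      unfolding mat_app_def by (simp add: infsum_cmult_right')
    also have "\<dots> = (\<Sum>\<^sub>\<infinity>y. \<Sum>x\<in>A. g x * (a x y * f y))"
      by (intro infsumI[symmetric] has_sum_finite_sum A has_sum_infsum summable_on_cmult_right s)
    also have "cmod \<dots> \<le> C * ell2_norm f * l2_on g A"
    proof (rule norm_infsum_le_finite_sums)
      fix B :: "'a set" assume B: "finite B"
      have "cmod (\<Sum>y\<in>B. \<Sum>x\<in>A. g x * (a x y * f y)) \<le> C * l2_on g A * l2_on f B"
        using form_boundD[OF assms(1) A B, of g f] by (subst sum.swap) (simp add: mult_ac)
      also have "\<dots> \<le> C * l2_on g A * ell2_norm f"
        by (intro mult_left_mono l2_on_le_ell2_norm assms B mult_nonneg_nonneg C) simp
      finally show "cmod (\<Sum>y\<in>B. \<Sum>x\<in>A. g x * (a x y * f y)) \<le> C * ell2_norm f * l2_on g A"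
        by (simp add: mult_ac)
    qed
    finally show "cmod (\<Sum>x\<in>A. g x * mat_app a f x) \<le> C * ell2_norm f * l2_on g A" .
  qed (use C in simp)
  thus "ell2 (mat_app a f)" "ell2_norm (mat_app a f) \<le> C * ell2_norm f"
    using ell2I[of "mat_app a f" "C * ell2_norm f"] by auto
qed

lemma bounded_mat_form_bound:
  assumes "bounded_mat a" "\<forall>f. ell2 f \<longrightarrow> ell2_norm (mat_app a f) \<le> C * ell2_norm f"
  shows "form_bound C a"
  unfolding form_bound_def
proof (intro allI impI)
  fix A B :: "'a set" and g f :: "'a \<Rightarrow> complex" assume fin: "finite A" "finite B"
  \<comment> \<open>Cutting \<open>f\<close> off outside \<open>B\<close> yields a genuine ell2
    vector of norm \<open>l2_on f B\<close>, on which \<open>a\<close> acts by finite sums.\<close>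
  define u where "u y = (if y \<in> B then f y else 0)" for y
  have u: "ell2 u" "ell2_norm u = l2_on f B"
    using ell2_finite_support[of B u] fin by (auto simp: u_def cong: L2_set_cong)
  have app: "mat_app a u x = (\<Sum>y\<in>B. a x y * f y)" for x
    unfolding mat_app_def using fin
    by (intro infsumI has_sum_finite_neutralI[of B]) (auto simp: u_def)
  have "(\<Sum>x\<in>A. \<Sum>y\<in>B. g x * a x y * f y) = (\<Sum>x\<in>A. g x * mat_app a u x)"
    by (simp add: app sum_distrib_left mult_ac)
  also have "cmod \<dots> \<le> l2_on g A * l2_on (mat_app a u) A" by (rule norm_sum_Cauchy_Schwarz)
  also have "\<dots> \<le> l2_on g A * ell2_norm (mat_app a u)"
    using assms(1) u fin by (intro mult_left_mono l2_on_le_ell2_norm) (auto simp: bounded_mat_def)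
  also have "\<dots> \<le> l2_on g A * (C * l2_on f B)"
    using assms(2) u by (intro mult_left_mono) auto
  finally show "cmod (\<Sum>x\<in>A. \<Sum>y\<in>B. g x * a x y * f y) \<le> C * l2_on g A * l2_on f B"
    by (simp add: mult_ac)
qed

lemma bounded_matI: 
  assumes "form_bound C a" shows "bounded_mat a"
  unfolding bounded_mat_def
  using form_bound_app[OF assms] ell2_Cauchy_Schwarz(1)[OF form_bound_row(1)[OF assms]] by blast

lemma opnorm_le:
  assumes "form_bound C a" shows "opnorm a \<le> C"
  unfolding opnorm_def
  using form_bound_app(2)[OF assms] form_bound_nonneg[OF assms]
  by (intro cInf_lower) (auto intro!: bdd_belowI[of _ 0])

text \<open>The infimum defining \<open>opnorm\<close> is itself an admissible constant, because the
  form inequality is linear in the constant. If the product of the two norms is zero, any admissible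
  constant already makes the left side vanish; otherwise one divides by it.\<close>

lemma form_bound_opnorm:
  assumes "bounded_mat a" shows "form_bound (opnorm a) a"
  unfolding form_bound_def
proof (intro allI impI)
  fix A B :: "'a set" and g f :: "'a \<Rightarrow> complex" assume fin: "finite A" "finite B"
  let ?S = "{C. C \<ge> 0 \<and> (\<forall>f. ell2 f \<longrightarrow> ell2_norm (mat_app a f) \<le> C * ell2_norm f)}"
  let ?L = "cmod (\<Sum>x\<in>A. \<Sum>y\<in>B. g x * a x y * f y)" and ?K = "l2_on g A * l2_on f B"
  obtain C0 where C0: "\<forall>f. ell2 f \<longrightarrow> ell2_norm (mat_app a f) \<le> C0 * ell2_norm f"
    using assms unfolding bounded_mat_def by blast
  \<comment> \<open>\<open>bounded_mat\<close> does not ask for a nonnegative constant while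
    \<open>?S\<close> does; a form bound dominates the modulus of an entry, which settles the
    sign.\<close>
  have "C0 \<in> ?S" using C0 form_bound_nonneg[OF bounded_mat_form_bound[OF assms C0]] by simp
  have le: "?L \<le> C * ?K" if "C \<in> ?S" for C
    using form_boundD[OF bounded_mat_form_bound[OF assms] fin, of C g f] that by (simp add: mult_ac)
  have "?L \<le> Inf ?S * ?K"
  proof (cases "?K = 0")
    case True thus ?thesis using le[OF \<open>C0 \<in> ?S\<close>] unfolding True by simp
  next
    case False
    hence K: "?K > 0" by (simp add: less_le del: mult_eq_0_iff)
    have "?L / ?K \<le> Inf ?S"
    proof (rule cInf_greatest)
      show "?S \<noteq> {}" using \<open>C0 \<in> ?S\<close> by blast
      show "?L / ?K \<le> C" if "C \<in> ?S" for C using le[OF that] K by (simp add: divide_le_eq)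
    qed
    thus ?thesis using K by (simp add: divide_le_eq)
  qed
  thus "?L \<le> opnorm a * l2_on g A * l2_on f B" by (simp add: opnorm_def mult_ac)
qed

section \<open>The uniform Roe algebra\<close>

lemma bounded_mat_iff: "bounded_mat a \<longleftrightarrow> (\<exists>C. form_bound C a)"
  using bounded_matI form_bound_opnorm by blast

lemma norm_entry_le_opnorm: "bounded_mat a \<Longrightarrow> cmod (a x y) \<le> opnorm a"
  by (rule form_bound_entry[OF form_bound_opnorm])

lemma form_bound_finite_app:
  assumes "form_bound C a" "finite B"
  shows "ell2 (\<lambda>x. \<Sum>y\<in>B. a x y * f y)"
    and "ell2_norm (\<lambda>x. \<Sum>y\<in>B. a x y * f y) \<le> C * l2_on f B"
proof -
  have "l2_on (\<lambda>x. \<Sum>y\<in>B. a x y * f y) A \<le> C * l2_on f B" if "finite A" for A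
  proof (rule l2_on_dual)
    fix g show "cmod (\<Sum>x\<in>A. g x * (\<Sum>y\<in>B. a x y * f y)) \<le> C * l2_on f B * l2_on g A"
      using form_boundD[OF assms(1) that assms(2), of g f] by (simp add: sum_distrib_left mult_ac)
  qed (use form_bound_nonneg[OF assms(1)] in simp)
  thus "ell2 (\<lambda>x. \<Sum>y\<in>B. a x y * f y)"
    "ell2_norm (\<lambda>x. \<Sum>y\<in>B. a x y * f y) \<le> C * l2_on f B"
    using ell2I[of "\<lambda>x. \<Sum>y\<in>B. a x y * f y" "C * l2_on f B"] by auto
qed

lemma mat_mult_abs_summable:
  assumes "form_bound C a" "form_bound D b"
  shows "(\<lambda>z. cmod (a x z * b z y)) summable_on UNIV"
  by (rule ell2_Cauchy_Schwarz(1)[OF form_bound_row(1)[OF assms(1)] form_bound_col(1)[OF assms(2)]])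

lemma mat_mult_has_sum:
  assumes "form_bound C a" "form_bound D b"
  shows "((\<lambda>z. a x z * b z y) has_sum mat_mult a b x y) UNIV"
  unfolding mat_mult_def
  by (rule has_sum_infsum[OF abs_summable_summable[OF mat_mult_abs_summable[OF assms]]])

text \<open>The form of the product is the pairing of \<open>u\<close>, the transpose of
  \<open>a\<close> applied to \<open>g\<close>, with \<open>v\<close>, which is \<open>b\<close>
  applied to \<open>f\<close>. Cauchy-Schwarz and the two separate bounds finish the
  estimate.\<close>

lemma form_bound_mult:
  assumes "form_bound C a" "form_bound D b" shows "form_bound (C * D) (mat_mult a b)"
  unfolding form_bound_def
proof (intro allI impI)
  fix A B :: "'a set" and g f :: "'a \<Rightarrow> complex" assume fin: "finite A" "finite B"
  define u where "u z = (\<Sum>x\<in>A. a x z * g x)" for z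
  define v where "v z = (\<Sum>y\<in>B. b z y * f y)" for z
  have u: "ell2 u" "ell2_norm u \<le> C * l2_on g A"
    using form_bound_finite_app[OF form_bound_transpose[OF assms(1)] fin(1), of g]
    by (simp_all add: u_def[abs_def])
  have v: "ell2 v" "ell2_norm v \<le> D * l2_on f B"
    using form_bound_finite_app[OF assms(2) fin(2), of f] by (simp_all add: v_def[abs_def])
  have "((\<lambda>z. \<Sum>x\<in>A. \<Sum>y\<in>B. g x * (a x z * b z y) * f y) has_sum
      (\<Sum>x\<in>A. \<Sum>y\<in>B. g x * mat_mult a b x y * f y)) UNIV"
    by (intro has_sum_finite_sum fin has_sum_cmult_left has_sum_cmult_right mat_mult_has_sum[OF assms])
  also have "(\<lambda>z. \<Sum>x\<in>A. \<Sum>y\<in>B. g x * (a x z * b z y) * f y) = (\<lambda>z. u z * v z)"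
    unfolding u_def v_def sum_product by (simp add: mult_ac)
  finally have "(\<Sum>x\<in>A. \<Sum>y\<in>B. g x * mat_mult a b x y * f y) = (\<Sum>\<^sub>\<infinity>z. u z * v z)"
    by (simp add: infsumI)
  also have "cmod \<dots> \<le> (\<Sum>\<^sub>\<infinity>z. cmod (u z * v z))"
    by (rule norm_infsum_bound) (rule ell2_Cauchy_Schwarz[OF u(1) v(1)])
  also have "\<dots> \<le> ell2_norm u * ell2_norm v" by (rule ell2_Cauchy_Schwarz[OF u(1) v(1)])
  also have "\<dots> \<le> (C * l2_on g A) * (D * l2_on f B)"
    by (intro mult_mono u v mult_nonneg_nonneg form_bound_nonneg[OF assms(1)]) auto
  finally show "cmod (\<Sum>x\<in>A. \<Sum>y\<in>B. g x * mat_mult a b x y * f y)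
      \<le> C * D * l2_on g A * l2_on f B"
    by (simp add: mult_ac)
qed

text \<open>This splitting lets products be approximated factor by factor. Boundedness makes all the
  series converge, so that the termwise identity can be summed.\<close>

lemma mat_sub_mult:
  assumes "bounded_mat a" "bounded_mat a'" "bounded_mat b" "bounded_mat b'"
  shows "mat_sub (mat_mult a a') (mat_mult b b')
       = mat_add (mat_mult a (mat_sub a' b')) (mat_mult (mat_sub a b) b')"
proof (intro ext)
  fix x y
  from assms obtain A A' B B' where bd: "form_bound A a" "form_bound A' a'" "form_bound B b" "form_bound B' b'"
    unfolding bounded_mat_iff by blast
  have s1: "((\<lambda>z. a x z * (mat_sub a' b') z y + mat_sub a b x z * b' z y) has_sum
      (mat_add (mat_mult a (mat_sub a' b')) (mat_mult (mat_sub a b) b') x y)) UNIV"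
    unfolding mat_add_def
    by (intro has_sum_add mat_mult_has_sum[OF bd(1) form_bound_sub[OF bd(2,4)]]
        mat_mult_has_sum[OF form_bound_sub[OF bd(1,3)] bd(4)])
  have s2: "((\<lambda>z. a x z * a' z y + - (b x z * b' z y)) has_sum
      (mat_mult a a' x y + - mat_mult b b' x y)) UNIV"
    by (rule has_sum_add[OF mat_mult_has_sum[OF bd(1,2)] has_sum_uminusI[OF mat_mult_has_sum[OF bd(3,4)]]])
  have eq: "(\<lambda>z. a x z * (mat_sub a' b') z y + mat_sub a b x z * b' z y)
      = (\<lambda>z. a x z * a' z y + - (b x z * b' z y))"
    by (simp add: mat_sub_def algebra_simps)
  have "mat_add (mat_mult a (mat_sub a' b')) (mat_mult (mat_sub a b) b') x y
      = mat_mult a a' x y + - mat_mult b b' x y"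
    by (rule has_sum_unique[OF s1[unfolded eq] s2])
  thus "mat_sub (mat_mult a a') (mat_mult b b') x y
    = mat_add (mat_mult a (mat_sub a' b')) (mat_mult (mat_sub a b) b') x y"
    by (simp add: mat_sub_def)
qed

section \<open>Finite propagation under algebraic operations\<close>

lemma finite_prop_add:
  assumes "finite_prop a" "finite_prop b" shows "finite_prop (mat_add a b)"
proof -
  from assms obtain R S where R: "\<And>x y. a x y \<noteq> 0 \<Longrightarrow> dist x y \<le> R"
    and S: "\<And>x y. b x y \<noteq> 0 \<Longrightarrow> dist x y \<le> S"
    unfolding finite_prop_def by blast
  have "dist x y \<le> max R S" if "mat_add a b x y \<noteq> 0" for x y
    using that R[of x y] S[of x y] by (cases "a x y = 0") (auto simp: mat_add_def le_max_iff_disj)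
  thus ?thesis unfolding finite_prop_def by blast
qed

lemma finite_prop_smul: "finite_prop a \<Longrightarrow> finite_prop (mat_smul c a)"
  unfolding finite_prop_def mat_smul_def by auto

lemma finite_prop_adj: "finite_prop a \<Longrightarrow> finite_prop (mat_adj a)"
  unfolding finite_prop_def mat_adj_def by (subst dist_commute) auto

lemma finite_prop_mult:
  assumes "finite_prop a" "finite_prop b" shows "finite_prop (mat_mult a b)"
proof -
  from assms obtain R S where R: "\<And>x y. a x y \<noteq> 0 \<Longrightarrow> dist x y \<le> R"
    and S: "\<And>x y. b x y \<noteq> 0 \<Longrightarrow> dist x y \<le> S"
    unfolding finite_prop_def by blast
  have "dist x y \<le> R + S" if "mat_mult a b x y \<noteq> 0" for x y
  proof -
    \<comment> \<open>A sum of zeros is zero, so a nonzero entry of the product has an intermediate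
      point \<open>z\<close> where both factors are nonzero; the triangle inequality then adds the
      propagations.\<close>
    from that obtain z where "a x z * b z y \<noteq> 0"
      unfolding mat_mult_def by (metis (no_types, lifting) infsum_0)
    thus ?thesis using R[of x z] S[of z y] dist_triangle[of x y z] by auto
  qed
  thus ?thesis unfolding finite_prop_def by blast
qed

text \<open>Form bounds pass through sums and products without any discussion of infima, so
  membership is tested with them. Using the tolerance \<open>e / 2\<close> recovers the strict
  inequality in the definition of \<open>uroe\<close>.\<close>

lemma uroeI:
  assumes "bounded_mat a"
    and "\<And>e. e > 0 \<Longrightarrow> \<exists>b. bounded_mat b \<and> finite_prop b \<and> form_bound e (mat_sub a b)"
  shows "a \<in> uroe"
  unfolding uroe_def
proof (intro CollectI conjI allI impI assms(1))
  fix e :: real assume "e > 0"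
  then obtain b where "bounded_mat b" "finite_prop b" "form_bound (e / 2) (mat_sub a b)"
    using assms(2)[of "e / 2"] by auto
  thus "\<exists>b. bounded_mat b \<and> finite_prop b \<and> opnorm (mat_sub a b) < e"
    using opnorm_le[of "e / 2" "mat_sub a b"] \<open>e > 0\<close> by (intro exI[of _ b]) auto
qed

lemma bounded_mat_sub: "bounded_mat a \<Longrightarrow> bounded_mat b \<Longrightarrow> bounded_mat (mat_sub a b)"
  unfolding bounded_mat_iff using form_bound_sub by blast

lemma uroe_bounded: "a \<in> uroe \<Longrightarrow> bounded_mat a"
  by (simp add: uroe_def)

lemma uroe_form_bound: "a \<in> uroe \<Longrightarrow> form_bound (opnorm a) a"
  by (rule form_bound_opnorm[OF uroe_bounded])

lemma uroe_approx:
  assumes "a \<in> uroe" "e > 0"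
  obtains b where "bounded_mat b" "finite_prop b" "form_bound e (mat_sub a b)"
proof -
  obtain b where "bounded_mat b" "finite_prop b" "opnorm (mat_sub a b) < e"
    using assms unfolding uroe_def by blast
  thus ?thesis
    using that form_bound_mono[OF form_bound_opnorm[OF bounded_mat_sub[OF uroe_bounded[OF assms(1)]]]]
    by (metis less_imp_le)
qed

section \<open>Closure properties of the uniform Roe algebra\<close>

lemma uroe_finite_prop:
  assumes "form_bound C a" "finite_prop a" shows "a \<in> uroe"
proof (rule uroeI)
  show "bounded_mat a" by (rule bounded_matI[OF assms(1)])
  fix e :: real assume "e > 0"
  have "form_bound e (mat_sub a a)"
    unfolding form_bound_def mat_sub_def using \<open>e > 0\<close> by simp
  thus "\<exists>b. bounded_mat b \<and> finite_prop b \<and> form_bound e (mat_sub a b)"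
    using assms(2) \<open>bounded_mat a\<close> by blast
qed

lemma uroe_smul:
  assumes "a \<in> uroe" shows "mat_smul c a \<in> uroe"
proof (rule uroeI)
  show "bounded_mat (mat_smul c a)"
    using form_bound_smul[OF uroe_form_bound[OF assms]] by (rule bounded_matI)
  fix e :: real assume "e > 0"
  \<comment> \<open>Adding 1 to \<open>cmod c\<close> keeps the denominator positive when
    \<open>c = 0\<close>.\<close>
  then obtain b where b: "bounded_mat b" "finite_prop b" "form_bound (e / (cmod c + 1)) (mat_sub a b)"
    using uroe_approx[OF assms, of "e / (cmod c + 1)"] by (auto simp: add_nonneg_pos)
  have "mat_sub (mat_smul c a) (mat_smul c b) = mat_smul c (mat_sub a b)"
    by (simp add: mat_sub_def mat_smul_def algebra_simps)
  moreover have "cmod c * (e / (cmod c + 1)) \<le> e"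
    using \<open>e > 0\<close> add_nonneg_pos[of "cmod c" 1] by (simp add: divide_le_eq algebra_simps)
  ultimately have "form_bound e (mat_sub (mat_smul c a) (mat_smul c b))"
    using form_bound_mono[OF form_bound_smul[OF b(3)]] by metis
  thus "\<exists>b. bounded_mat b \<and> finite_prop b \<and> form_bound e (mat_sub (mat_smul c a) b)"
    using finite_prop_smul[OF b(2)] form_bound_smul[of _ b c] b(1) unfolding bounded_mat_iff by blast
qed

lemma uroe_adj:
  assumes "a \<in> uroe" shows "mat_adj a \<in> uroe"
proof (rule uroeI)
  show "bounded_mat (mat_adj a)"
    using form_bound_adj[OF uroe_form_bound[OF assms]] by (rule bounded_matI)
  fix e :: real assume "e > 0"
  then obtain b where b: "bounded_mat b" "finite_prop b" "form_bound e (mat_sub a b)"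
    using uroe_approx[OF assms] by blast
  have "mat_sub (mat_adj a) (mat_adj b) = mat_adj (mat_sub a b)"
    by (simp add: mat_sub_def mat_adj_def)
  thus "\<exists>b. bounded_mat b \<and> finite_prop b \<and> form_bound e (mat_sub (mat_adj a) b)"
    using finite_prop_adj[OF b(2)] form_bound_adj[OF b(3)] form_bound_adj[of _ b] b(1)
    unfolding bounded_mat_iff by metis
qed

lemma uroe_mult:
  assumes "a \<in> uroe" "a' \<in> uroe" shows "mat_mult a a' \<in> uroe"
proof (rule uroeI)
  obtain C where C: "form_bound C a"
    using uroe_form_bound assms by blast
  show "bounded_mat (mat_mult a a')"
    using form_bound_mult[OF C uroe_form_bound[OF assms(2)]] by (rule bounded_matI)
  fix e :: real assume e: "e > 0"
  have C0: "C \<ge> 0" by (rule form_bound_nonneg[OF C])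
  \<comment> \<open>The right factor is approximated first: the tolerance for the left factor
    depends on a bound \<open>D\<close> of \<open>b'\<close>. The summands 1 keep both denominators
    positive.\<close>
  obtain b' where b': "bounded_mat b'" "finite_prop b'" "form_bound (e / (2 * (C + 1))) (mat_sub a' b')"
    using uroe_approx[OF assms(2), of "e / (2 * (C + 1))"] e C0 by auto
  obtain D where D: "form_bound D b'"
    using b'(1) bounded_mat_iff by blast
  have D0: "D \<ge> 0" by (rule form_bound_nonneg[OF D])
  obtain b where b: "bounded_mat b" "finite_prop b" "form_bound (e / (2 * (D + 1))) (mat_sub a b)"
    using uroe_approx[OF assms(1), of "e / (2 * (D + 1))"] e D0 by auto
  have "form_bound (C * (e / (2 * (C + 1))) + e / (2 * (D + 1)) * D)
      (mat_sub (mat_mult a a') (mat_mult b b'))"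
    unfolding mat_sub_mult[OF uroe_bounded[OF assms(1)] uroe_bounded[OF assms(2)] b(1) b'(1)]
    by (intro form_bound_add form_bound_mult C D b b')
  moreover have "C * (e / (2 * (C + 1))) \<le> e / 2" "e / (2 * (D + 1)) * D \<le> e / 2"
    using e C0 D0 by (simp_all add: field_simps)
  hence "C * (e / (2 * (C + 1))) + e / (2 * (D + 1)) * D \<le> e"
    by linarith
  ultimately have "form_bound e (mat_sub (mat_mult a a') (mat_mult b b'))"
    by (rule form_bound_mono)
  moreover have "bounded_mat (mat_mult b b')"
    using b(1) b'(1) form_bound_mult unfolding bounded_mat_iff by blast
  ultimately show "\<exists>c. bounded_mat c \<and> finite_prop c \<and> form_bound e (mat_sub (mat_mult a a') c)"
    using finite_prop_mult[OF b(2) b'(2)] by blast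
qed

lemma uroe_add:
  assumes "a \<in> uroe" "a' \<in> uroe" shows "mat_add a a' \<in> uroe"
proof (rule uroeI)
  show "bounded_mat (mat_add a a')"
    using form_bound_add[OF uroe_form_bound[OF assms(1)] uroe_form_bound[OF assms(2)]]
    by (rule bounded_matI)
  fix e :: real assume e: "e > 0"
  obtain b where b: "bounded_mat b" "finite_prop b" "form_bound (e / 2) (mat_sub a b)"
    using uroe_approx[OF assms(1), of "e / 2"] e by auto
  obtain b' where b': "bounded_mat b'" "finite_prop b'" "form_bound (e / 2) (mat_sub a' b')"
    using uroe_approx[OF assms(2), of "e / 2"] e by auto
  have "mat_sub (mat_add a a') (mat_add b b') = mat_add (mat_sub a b) (mat_sub a' b')"
    by (simp add: mat_sub_def mat_add_def algebra_simps)
  hence "form_bound e (mat_sub (mat_add a a') (mat_add b b'))"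
    using form_bound_add[OF b(3) b'(3)] by simp
  moreover have "bounded_mat (mat_add b b')"
    using b(1) b'(1) form_bound_add unfolding bounded_mat_iff by blast
  ultimately show "\<exists>c. bounded_mat c \<and> finite_prop c \<and> form_bound e (mat_sub (mat_add a a') c)"
    using finite_prop_add[OF b(2) b'(2)] by blast
qed

section \<open>Row truncations and matrix units\<close>

definition row_restrict :: "'a set \<Rightarrow> 'a mat \<Rightarrow> 'a mat" where
  "row_restrict A a = (\<lambda>x y. if x \<in> A then a x y else 0)"

definition mat_unit :: "'a \<Rightarrow> 'a \<Rightarrow> 'a mat" where
  "mat_unit x y = (\<lambda>u v. if u = x \<and> v = y then 1 else 0)"

text \<open>Truncation, that is left multiplication by a coordinate projection, only replaces
  \<open>A\<close> by \<open>A \<inter> F\<close> in the form. The bound is uniform in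
  \<open>F\<close>, so all truncations of one matrix lie in a bounded set.\<close>

lemma form_bound_row_restrict:
  assumes "form_bound C a" shows "form_bound C (row_restrict F a)"
  unfolding form_bound_def
proof (intro allI impI)
  fix A B :: "'a set" and g f :: "'a \<Rightarrow> complex" assume fin: "finite A" "finite B"
  have "(\<Sum>x\<in>A. \<Sum>y\<in>B. g x * row_restrict F a x y * f y) = (\<Sum>x\<in>A \<inter> F. \<Sum>y\<in>B. g x * a x y * f y)"
    using fin by (subst sum.inter_restrict) (auto simp: row_restrict_def intro!: sum.cong)
  also have "cmod \<dots> \<le> C * l2_on g (A \<inter> F) * l2_on f B"
    using fin by (intro form_boundD assms) auto
  also have "\<dots> \<le> C * l2_on g A * l2_on f B"
    using fin form_bound_nonneg[OF assms]
    by (intro mult_right_mono mult_left_mono l2_on_subset) auto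
  finally show "cmod (\<Sum>x\<in>A. \<Sum>y\<in>B. g x * row_restrict F a x y * f y) \<le> C * l2_on g A * l2_on f B" .
qed

lemma uroe_row_restrict:
  assumes "a \<in> uroe" shows "row_restrict F a \<in> uroe"
proof (rule uroeI)
  show "bounded_mat (row_restrict F a)"
    using form_bound_row_restrict[OF uroe_form_bound[OF assms]] by (rule bounded_matI)
  fix e :: real assume "e > 0"
  then obtain b where b: "bounded_mat b" "finite_prop b" "form_bound e (mat_sub a b)"
    using uroe_approx[OF assms] by blast
  have "mat_sub (row_restrict F a) (row_restrict F b) = row_restrict F (mat_sub a b)"
    by (auto simp: mat_sub_def row_restrict_def fun_eq_iff)
  hence "form_bound e (mat_sub (row_restrict F a) (row_restrict F b))"
    using form_bound_row_restrict[OF b(3)] by simp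
  moreover have "finite_prop (row_restrict F b)"
    using b(2) unfolding finite_prop_def row_restrict_def by auto
  moreover have "bounded_mat (row_restrict F b)"
    using b(1) form_bound_row_restrict unfolding bounded_mat_iff by blast
  ultimately show "\<exists>c. bounded_mat c \<and> finite_prop c \<and> form_bound e (mat_sub (row_restrict F a) c)"
    by blast
qed

lemma form_bound_unit: "form_bound 1 (mat_unit x y)"
  unfolding form_bound_def
proof (intro allI impI)
  fix A B :: "'a set" and g f :: "'a \<Rightarrow> complex" assume fin: "finite A" "finite B"
  have "(\<Sum>u\<in>A. \<Sum>v\<in>B. g u * mat_unit x y u v * f v)
    = (\<Sum>u\<in>A. if u = x then (\<Sum>v\<in>B. if v = y then g x * f y else 0) else 0)"
    by (auto simp: mat_unit_def intro!: sum.cong)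
  also have "cmod \<dots> = (if x \<in> A \<and> y \<in> B then cmod (g x) * cmod (f y) else 0)"
    using fin by (simp add: norm_mult)
  also have "\<dots> \<le> l2_on g A * l2_on f B"
    using fin by (auto intro!: mult_mono member_le_L2_set[of _ _ "\<lambda>x. cmod (_ x)"])
  finally show "cmod (\<Sum>u\<in>A. \<Sum>v\<in>B. g u * mat_unit x y u v * f v) \<le> 1 * l2_on g A * l2_on f B"
    by simp
qed

lemma uroe_unit: "mat_unit x y \<in> uroe"
  by (rule uroe_finite_prop[OF form_bound_unit]) (auto simp: finite_prop_def mat_unit_def)

lemma form_bound_id: "form_bound 1 mat_id"
  unfolding form_bound_def
proof (intro allI impI)
  fix A B :: "'a set" and g f :: "'a \<Rightarrow> complex" assume fin: "finite A" "finite B"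
  have "(\<Sum>x\<in>A. \<Sum>y\<in>B. g x * mat_id x y * f y) = (\<Sum>x\<in>A. \<Sum>y\<in>B. if y = x then g x * f x else 0)"
    by (auto simp: mat_id_def intro!: sum.cong)
  also have "\<dots> = (\<Sum>x\<in>A \<inter> B. g x * f x)"
    using fin by (simp add: sum.inter_restrict)
  also have "cmod \<dots> \<le> l2_on g (A \<inter> B) * l2_on f (A \<inter> B)"
    by (rule norm_sum_Cauchy_Schwarz)
  also have "\<dots> \<le> l2_on g A * l2_on f B"
    using fin by (intro mult_mono l2_on_subset) auto
  finally show "cmod (\<Sum>x\<in>A. \<Sum>y\<in>B. g x * mat_id x y * f y) \<le> 1 * l2_on g A * l2_on f B"
    by simp
qed

lemma uroe_id: "mat_id \<in> uroe"
  by (rule uroe_finite_prop[OF form_bound_id]) (auto simp: finite_prop_def mat_id_def)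

section \<open>Strongly continuous KMS states are Gibbs states\<close>

text \<open>Each entry is dominated by \<open>opnorm\<close>, so norm convergence of the difference
  quotients forces their entries to converge.\<close>

lemma op_entire_entry_holomorphic:
  assumes "op_entire F" shows "(\<lambda>z. F z x y) holomorphic_on UNIV"
proof -
  have "\<exists>d. ((\<lambda>z. F z x y) has_field_derivative d) (at z)" for z
  proof -
    obtain D where D: "bounded_mat D"
      and lim: "((\<lambda>w. opnorm (mat_sub (mat_smul (inverse (w - z)) (mat_sub (F w) (F z))) D)) \<longlongrightarrow> 0) (at z)"
      using assms unfolding op_entire_def by blast
    have bd: "bounded_mat (F w)" for w
      using assms unfolding op_entire_def by (blast intro: uroe_bounded)
    have "((\<lambda>w. (F w x y - F z x y) / (w - z) - D x y) \<longlongrightarrow> 0) (at z)"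
    proof (rule Lim_null_comparison[OF always_eventually lim], rule allI)
      fix w
      have "bounded_mat (mat_sub (mat_smul (inverse (w - z)) (mat_sub (F w) (F z))) D)"
        using bounded_mat_sub[OF bd bd, of w z] form_bound_smul bounded_mat_iff D bounded_mat_sub
        by metis
      from norm_entry_le_opnorm[OF this, of x y]
      show "cmod ((F w x y - F z x y) / (w - z) - D x y)
          \<le> opnorm (mat_sub (mat_smul (inverse (w - z)) (mat_sub (F w) (F z))) D)"
        by (simp add: mat_sub_def mat_smul_def divide_inverse mult.commute)
    qed
    hence "((\<lambda>w. (F w x y - F z x y) / (w - z)) \<longlongrightarrow> D x y) (at z)"
      by (rule LIM_zero_cancel)
    thus ?thesis unfolding has_field_derivative_iff by blast
  qed
  thus ?thesis by (auto simp: holomorphic_on_open)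
qed

text \<open>Both sides are entire in \<open>z\<close> and agree on the real line by the definition
  of the flow; since 0 is a limit point of the real line, the identity theorem applies. In
  particular the extension is determined by \<open>b\<close>.\<close>

lemma analytic_ext_entry:
  assumes "analytic_ext h b F"
  shows "F z x y = exp (\<i> * z * of_real (h x - h y)) * b x y"
proof -
  let ?g = "\<lambda>z. F z x y - exp (\<i> * z * of_real (h x - h y)) * b x y"
  have "?g z = 0"
  proof (rule analytic_continuation[of ?g UNIV "range complex_of_real" 0])
    show "?g holomorphic_on UNIV"
      using assms unfolding analytic_ext_def
      by (intro holomorphic_intros op_entire_entry_holomorphic) auto
    show "(0::complex) islimpt range complex_of_real"
      unfolding islimpt_approachable
    proof (intro allI impI)
      fix e :: real assume "e > 0"
      thus "\<exists>x'\<in>range complex_of_real. x' \<noteq> 0 \<and> dist x' 0 < e"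
        by (intro bexI[of _ "complex_of_real (e / 2)"] rangeI) auto
    qed
    show "?g w = 0" if "w \<in> range complex_of_real" for w
    proof -
      from that obtain t where w: "w = complex_of_real t" by blast
      have "F w x y = sigma h t b x y"
        using assms by (simp add: w analytic_ext_def)
      thus ?thesis
        by (simp add: w sigma_def mult_ac flip: exp_add) (simp add: algebra_simps)
    qed
  qed auto
  thus ?thesis by simp
qed

text \<open>The flow multiplies a matrix unit by a scalar exponential, so the candidate extension is
  a scalar entire function times a fixed matrix. The error in the operator difference quotient is at
  most the scalar error, as a matrix unit has form bound 1.\<close>

lemma analytic_ext_unit:
  "analytic_ext h (mat_unit x y) (\<lambda>z. mat_smul (exp (\<i> * z * of_real (h x - h y))) (mat_unit x y))"
proof -
  let ?c = "\<i> * of_real (h x - h y)"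
  let ?e = "\<lambda>z. exp (\<i> * z * of_real (h x - h y))"
  have "\<exists>D. bounded_mat D \<and> ((\<lambda>w. opnorm (mat_sub (mat_smul (inverse (w - z))
      (mat_sub (mat_smul (?e w) (mat_unit x y)) (mat_smul (?e z) (mat_unit x y)))) D)) \<longlongrightarrow> 0) (at z)" for z
  proof (intro exI[of _ "mat_smul (?c * ?e z) (mat_unit x y)"] conjI)
    show "bounded_mat (mat_smul (?c * ?e z) (mat_unit x y))"
      by (rule bounded_matI[OF form_bound_smul[OF form_bound_unit]])
    have "(?e has_field_derivative (?c * ?e z)) (at z)"
      by (auto intro!: derivative_eq_intros simp: algebra_simps)
    hence lim: "((\<lambda>w. (?e w - ?e z) / (w - z) - ?c * ?e z) \<longlongrightarrow> 0) (at z)"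
      unfolding has_field_derivative_iff by (rule LIM_zero)
    have eq: "mat_sub (mat_smul (inverse (w - z))
        (mat_sub (mat_smul (?e w) (mat_unit x y)) (mat_smul (?e z) (mat_unit x y))))
        (mat_smul (?c * ?e z) (mat_unit x y))
      = mat_smul ((?e w - ?e z) / (w - z) - ?c * ?e z) (mat_unit x y)" for w
      by (simp add: mat_sub_def mat_smul_def divide_inverse algebra_simps)
    show "((\<lambda>w. opnorm (mat_sub (mat_smul (inverse (w - z))
        (mat_sub (mat_smul (?e w) (mat_unit x y)) (mat_smul (?e z) (mat_unit x y))))
        (mat_smul (?c * ?e z) (mat_unit x y)))) \<longlongrightarrow> 0) (at z)"
      unfolding eq
    proof (rule Lim_null_comparison[OF always_eventually tendsto_norm_zero[OF lim]], rule allI)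
      fix w
      let ?m = "mat_smul ((?e w - ?e z) / (w - z) - ?c * ?e z) (mat_unit x y)"
      have fb: "form_bound (cmod ((?e w - ?e z) / (w - z) - ?c * ?e z)) ?m"
        using form_bound_smul[OF form_bound_unit] by (metis mult.right_neutral)
      have "opnorm ?m \<ge> 0"
        by (rule form_bound_nonneg[OF form_bound_opnorm[OF bounded_matI[OF fb]]])
      thus "norm (opnorm ?m) \<le> cmod ((?e w - ?e z) / (w - z) - ?c * ?e z)"
        using opnorm_le[OF fb] by simp
    qed
  qed
  moreover have "mat_smul (?e (of_real t)) (mat_unit x y) = sigma h t (mat_unit x y)" for t
    by (auto simp: fun_eq_iff mat_smul_def sigma_def mat_unit_def algebra_simps simp flip: exp_add)
  ultimately show ?thesis
    unfolding analytic_ext_def op_entire_def using uroe_smul[OF uroe_unit] by blast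
qed

section \<open>The KMS condition tested on matrix units\<close>

lemma mat_mult_unit_right: "mat_mult a (mat_unit x y) = (\<lambda>u v. if v = y then a u x else 0)"
proof (intro ext)
  fix u v
  have "((\<lambda>z. a u z * mat_unit x y z v) has_sum (if v = y then a u x else 0)) UNIV"
    by (rule has_sum_finite_neutralI[of "{x}"]) (auto simp: mat_unit_def)
  thus "mat_mult a (mat_unit x y) u v = (if v = y then a u x else 0)"
    unfolding mat_mult_def by (rule infsumI)
qed

lemma mat_mult_unit_left: "mat_mult (mat_unit x y) a = (\<lambda>u v. if u = x then a y v else 0)"
proof (intro ext)
  fix u v
  have "((\<lambda>z. mat_unit x y u z * a z v) has_sum (if u = x then a y v else 0)) UNIV"
    by (rule has_sum_finite_neutralI[of "{y}"]) (auto simp: mat_unit_def)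
  thus "mat_mult (mat_unit x y) a u v = (if u = x then a y v else 0)"
    unfolding mat_mult_def by (rule infsumI)
qed

lemma KMS_unit:
  assumes "is_KMS h \<beta> \<phi>" "a \<in> uroe"
  shows "\<phi> (mat_mult a (mat_smul (exp (\<i> * (\<i> * of_real \<beta>) * of_real (h x - h y))) (mat_unit x y)))
       = \<phi> (mat_mult (mat_unit x y) a)"
  using assms analytic_ext_unit[of h x y] uroe_unit[of x y] unfolding is_KMS_def by blast

text \<open>Apply the KMS condition to the units at \<open>(y, x)\<close> and \<open>(x, y)\<close>:
  their two products are the diagonal units at \<open>y\<close> and at \<open>x\<close>, and
  evaluating the flow at \<open>\<i> * \<beta>\<close> contributes the exponential.\<close>

lemma KMS_diagonal:
  assumes "is_KMS h \<beta> \<phi>"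
  shows "\<phi> (mat_unit x x) = exp (- of_real \<beta> * of_real (h x - h y)) * \<phi> (mat_unit y y)"
proof -
  let ?c = "exp (\<i> * (\<i> * of_real \<beta>) * of_real (h x - h y))"
  have "mat_mult (mat_unit y x) (mat_smul ?c (mat_unit x y)) = mat_smul ?c (mat_unit y y)"
    unfolding mat_mult_unit_left by (auto simp: mat_smul_def mat_unit_def fun_eq_iff)
  moreover have "mat_mult (mat_unit x y) (mat_unit y x) = mat_unit x x"
    unfolding mat_mult_unit_left by (auto simp: mat_unit_def fun_eq_iff)
  moreover have "\<phi> (mat_smul ?c (mat_unit y y)) = ?c * \<phi> (mat_unit y y)"
    using assms uroe_unit[of y y] unfolding is_KMS_def is_state_def by blast
  ultimately have "?c * \<phi> (mat_unit y y) = \<phi> (mat_unit x x)"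
    using KMS_unit[OF assms uroe_unit, of y x x y] by simp
  moreover have "\<i> * (\<i> * complex_of_real \<beta>) = - of_real \<beta>" by (simp flip: mult.assoc)
  ultimately show ?thesis by simp
qed

text \<open>The diagonal unit is fixed by the flow, so for it the KMS condition is the trace
  identity. Multiplying the truncated row by the unit on the left leaves the row unchanged; on the
  right it leaves only the diagonal entry.\<close>

lemma KMS_row:
  assumes "is_KMS h \<beta> \<phi>" "a \<in> uroe"
  shows "\<phi> (row_restrict {x} a) = a x x * \<phi> (mat_unit x x)"
proof -
  have "mat_smul 1 (mat_unit x x) = mat_unit x x" by (simp add: mat_smul_def)
  hence "\<phi> (mat_mult (row_restrict {x} a) (mat_unit x x)) = \<phi> (mat_mult (mat_unit x x) (row_restrict {x} a))"
    using KMS_unit[OF assms(1) uroe_row_restrict[OF assms(2)], of "{x}" x x] by simp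
  moreover have "mat_mult (mat_unit x x) (row_restrict {x} a) = row_restrict {x} a"
    unfolding mat_mult_unit_left by (auto simp: row_restrict_def fun_eq_iff)
  moreover have "mat_mult (row_restrict {x} a) (mat_unit x x) = mat_smul (a x x) (mat_unit x x)"
    unfolding mat_mult_unit_right by (auto simp: row_restrict_def mat_smul_def mat_unit_def fun_eq_iff)
  moreover have "\<phi> (mat_smul (a x x) (mat_unit x x)) = a x x * \<phi> (mat_unit x x)"
    using assms uroe_unit[of x x] unfolding is_KMS_def is_state_def by blast
  ultimately show ?thesis by simp
qed

lemma KMS_finite_rows:
  assumes "is_KMS h \<beta> \<phi>" "a \<in> uroe" "finite A"
  shows "\<phi> (row_restrict A a) = (\<Sum>x\<in>A. a x x * \<phi> (mat_unit x x))"
  using assms(3)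
proof (induction A rule: finite_induct)
  case empty
  \<comment> \<open>The value at the zero matrix comes from homogeneity with scalar 0.\<close>
  have "\<phi> (mat_smul 0 a) = 0 * \<phi> a"
    using assms unfolding is_KMS_def is_state_def by blast
  moreover have "mat_smul 0 a = row_restrict {} a"
    by (simp add: mat_smul_def row_restrict_def)
  ultimately show ?case by simp
next
  case (insert x A)
  have "row_restrict (insert x A) a = mat_add (row_restrict {x} a) (row_restrict A a)"
    using insert(2) by (auto simp: row_restrict_def mat_add_def fun_eq_iff)
  moreover have "\<phi> (mat_add (row_restrict {x} a) (row_restrict A a))
      = \<phi> (row_restrict {x} a) + \<phi> (row_restrict A a)"
    using assms uroe_row_restrict[OF assms(2)] unfolding is_KMS_def is_state_def by blast
  ultimately show ?case using insert KMS_row[OF assms(1,2)] by simp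
qed

section \<open>From row truncations to the full matrix\<close>

lemma strongly_continuous_rows:
  assumes "strongly_continuous \<phi>" "a \<in> uroe"
  shows "((\<lambda>A. \<phi> (row_restrict A a)) \<longlongrightarrow> \<phi> a) (finite_subsets_at_top UNIV)"
proof (rule tendstoI)
  fix e :: real assume "e > 0"
  \<comment> \<open>Strong continuity is a statement about bounded sets; this one contains
    \<open>a\<close> and all its truncations, bounded by \<open>opnorm a\<close>.\<close>
  let ?B = "insert a (range (\<lambda>A. row_restrict A a))"
  have B: "?B \<subseteq> uroe" using assms(2) uroe_row_restrict by auto
  have bd: "\<exists>M. \<forall>b\<in>?B. opnorm b \<le> M"
    using opnorm_le[OF form_bound_row_restrict[OF uroe_form_bound[OF assms(2)]]] by (intro exI[of _ "opnorm a"]) auto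
  have "a \<in> ?B" by simp
  note assms(1)[unfolded strongly_continuous_def, THEN spec, THEN mp, OF B, THEN mp, OF bd,
      THEN bspec, OF this, THEN spec, THEN mp, OF \<open>e > 0\<close>]
  then obtain V \<delta> where V: "finite V" "\<forall>\<xi>\<in>V. ell2 \<xi>" "\<delta> > 0"
    and cont: "\<forall>b\<in>?B. (\<forall>\<xi>\<in>V. ell2_norm (mat_app (mat_sub b a) \<xi>) < \<delta>) \<longrightarrow> cmod (\<phi> b - \<phi> a) < e"
    by blast
  have "\<forall>\<^sub>F A in finite_subsets_at_top UNIV. \<forall>\<xi>\<in>V. ell2_norm (mat_app (mat_sub (row_restrict A a) a) \<xi>) < \<delta>"
  proof (rule eventually_ball_finite[OF V(1)], rule ballI)
    fix \<xi> assume "\<xi> \<in> V"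
    let ?u = "\<lambda>x. - mat_app a \<xi> x"
    have "ell2 (mat_app a \<xi>)"
      using form_bound_app(1)[OF uroe_form_bound[OF assms(2)]] V(2) \<open>\<xi> \<in> V\<close> by blast
    hence "ell2 ?u" by (simp add: ell2_def)
    \<comment> \<open>On each test vector the error is minus the tail of the ell2 vector
      \<open>mat_app a \<xi>\<close> outside \<open>A\<close>, so it tends to zero.\<close>
    moreover have "mat_app (mat_sub (row_restrict A a) a) \<xi> = (\<lambda>x. if x \<in> A then 0 else ?u x)" for A
      by (auto simp: mat_app_def mat_sub_def row_restrict_def infsum_uminus)
    ultimately show "\<forall>\<^sub>F A in finite_subsets_at_top UNIV.
        ell2_norm (mat_app (mat_sub (row_restrict A a) a) \<xi>) < \<delta>"
      using order_tendstoD(2)[OF ell2_tail_tendsto \<open>\<delta> > 0\<close>, of ?u] by simp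
  qed
  thus "\<forall>\<^sub>F A in finite_subsets_at_top UNIV. dist (\<phi> (row_restrict A a)) (\<phi> a) < e"
    by (rule eventually_mono) (use cont in \<open>auto simp: dist_norm\<close>)
qed

lemma KMS_has_sum:
  assumes "is_KMS h \<beta> \<phi>" "strongly_continuous \<phi>" "a \<in> uroe"
  shows "((\<lambda>x. a x x * \<phi> (mat_unit x x)) has_sum \<phi> a) UNIV"
  unfolding has_sum_def
  by (rule Lim_transform_eventually[OF strongly_continuous_rows[OF assms(2,3)]])
    (rule eventually_finite_subsets_at_top_weakI, simp add: KMS_finite_rows[OF assms(1,3)])

text \<open>All the weights \<open>\<phi> (mat_unit x x)\<close> are one constant \<open>c\<close>
  times \<open>exp (- \<beta> * h x)\<close>. Evaluating the expansion of \<open>KMS_has_sum\<close>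
  at the identity gives the convergence of the partition function and identifies its value as
  \<open>inverse c\<close>.\<close>

lemma KMS_gibbs:
  assumes "is_KMS h \<beta> \<phi>" "strongly_continuous \<phi>"
  shows "(\<lambda>x. exp (- \<beta> * h x)) summable_on UNIV"
    and "a \<in> uroe \<Longrightarrow> \<phi> a = (1 / complex_of_real (\<Sum>\<^sub>\<infinity>x. exp (- \<beta> * h x)))
            * (\<Sum>\<^sub>\<infinity>x. a x x * complex_of_real (exp (- \<beta> * h x)))"
proof -
  fix x0 :: 'a
  let ?w = "\<lambda>x. exp (- \<beta> * h x)"
  \<comment> \<open>Normalising at the arbitrary base point \<open>x0\<close> removes the dependence
    of the proportionality factor on it.\<close>
  define c where "c = \<phi> (mat_unit x0 x0) * of_real (exp (\<beta> * h x0))"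
  have unit: "\<phi> (mat_unit x x) = c * of_real (?w x)" for x
    unfolding KMS_diagonal[OF assms(1), of x x0] c_def
    by (simp add: algebra_simps exp_diff exp_minus field_simps flip: exp_of_real)
  have hs: "((\<lambda>x. c * (a x x * of_real (?w x))) has_sum \<phi> a) UNIV" if "a \<in> uroe" for a
    using KMS_has_sum[OF assms that] by (simp add: unit mult_ac)
  have "\<phi> mat_id = 1" using assms(1) by (simp add: is_KMS_def is_state_def)
  with hs[OF uroe_id] have one: "((\<lambda>x. c * of_real (?w x)) has_sum 1) UNIV"
    by (simp add: mat_id_def)
  have c: "c \<noteq> 0"
  proof
    assume "c = 0"
    with one have "((\<lambda>x::'a. 0) has_sum (1::complex)) UNIV" by simp
    thus False using has_sum_unique[OF has_sum_0_simp] zero_neq_one by blast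
  qed
  have "((\<lambda>x. inverse c * (c * of_real (?w x))) has_sum (inverse c * 1)) UNIV"
    by (rule has_sum_cmult_right[OF one])
  hence w: "((\<lambda>x. complex_of_real (?w x)) has_sum inverse c) UNIV"
    using c by (simp flip: mult.assoc)
  \<comment> \<open>Taking real parts converts the complex sum into a sum of the real weights, which
    is what the summability claim is about.\<close>
  hence "((\<lambda>x. Re (complex_of_real (?w x))) has_sum Re (inverse c)) UNIV"
    by (rule has_sum_Re)
  hence w': "(?w has_sum Re (inverse c)) UNIV" by simp
  thus "?w summable_on UNIV" by (rule has_sum_imp_summable)
  have "complex_of_real (infsum ?w UNIV) = inverse c"
    using has_sum_unique[OF w has_sum_of_real[OF w']] infsumI[OF w'] by simp
  hence cZ: "1 / complex_of_real (infsum ?w UNIV) = c"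
    by (simp only: inverse_eq_divide[symmetric] inverse_inverse_eq)
  show "\<phi> a = (1 / complex_of_real (infsum ?w UNIV)) * (\<Sum>\<^sub>\<infinity>x. a x x * of_real (?w x))" if "a \<in> uroe"
    using infsumI[OF hs[OF that]] unfolding cZ by (simp add: infsum_cmult_right')
qed

section \<open>The Gibbs state\<close>

lemma diagonal_summable:
  assumes "form_bound C a" "\<And>x. w x \<ge> 0" "w summable_on UNIV"
  shows "(\<lambda>x. cmod (a x x * complex_of_real (w x))) summable_on UNIV"
    and "(\<lambda>x. a x x * complex_of_real (w x)) summable_on UNIV"
proof -
  have "(\<lambda>x. C * w x) summable_on UNIV" by (intro summable_on_cmult_right assms)
  thus "(\<lambda>x. cmod (a x x * complex_of_real (w x))) summable_on UNIV"
    by (rule summable_on_comparison_test)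
      (auto simp: norm_mult assms(2) intro!: mult_right_mono form_bound_entry[OF assms(1)])
  thus "(\<lambda>x. a x x * complex_of_real (w x)) summable_on UNIV"
    by (rule abs_summable_summable)
qed

text \<open>The weight depends on \<open>z\<close> only. For fixed \<open>z\<close>, Cauchy-Schwarz
  between column \<open>z\<close> of \<open>a\<close> and row \<open>z\<close> of \<open>b\<close>
  bounds the absolute sum over \<open>x\<close> by \<open>C * D * w z\<close>, which is summable in
  \<open>z\<close>; absolute summability over pairs permits the interchange.\<close>

lemma weighted_trace_swap:
  assumes a: "form_bound C a" and b: "form_bound D b" and w: "\<And>x. w x \<ge> 0" "w summable_on UNIV"
  shows "(\<Sum>\<^sub>\<infinity>x. \<Sum>\<^sub>\<infinity>z. a x z * b z x * complex_of_real (w z))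
       = (\<Sum>\<^sub>\<infinity>z. \<Sum>\<^sub>\<infinity>x. a x z * b z x * complex_of_real (w z))"
proof -
  let ?f = "\<lambda>z x. a x z * b z x * complex_of_real (w z)"
  note CS = ell2_Cauchy_Schwarz[OF form_bound_col(1)[OF a] form_bound_row(1)[OF b]]
  have norm_f: "cmod (?f z x) = w z * cmod (a x z * b z x)" for z x
    by (simp add: norm_mult w mult_ac)
  have le: "(\<Sum>\<^sub>\<infinity>x. cmod (?f z x)) \<le> C * D * w z" for z
  proof -
    have "(\<Sum>\<^sub>\<infinity>x. cmod (a x z * b z x)) \<le> ell2_norm (\<lambda>x. a x z) * ell2_norm (b z)"
      by (rule CS(2))
    also have "\<dots> \<le> C * D"
      by (intro mult_mono form_bound_col[OF a] form_bound_row[OF b] form_bound_nonneg[OF a]) simp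
    finally show ?thesis
      using w(1)[of z] unfolding norm_f infsum_cmult_right' by (simp add: mult_left_mono mult.commute)
  qed
  have "(\<lambda>p. norm (case p of (z, x) \<Rightarrow> ?f z x)) summable_on UNIV \<times> UNIV"
    unfolding Infinite_Sum.abs_summable_on_Sigma_iff
  proof (intro conjI ballI)
    show "(\<lambda>x. norm (case (z, x) of (z, x) \<Rightarrow> ?f z x)) summable_on UNIV" for z
      unfolding prod.case norm_f by (intro summable_on_cmult_right CS(1))
    have "(\<lambda>z. \<Sum>\<^sub>\<infinity>x. cmod (?f z x)) summable_on UNIV"
      by (rule summable_on_comparison_test[OF summable_on_cmult_right[OF w(2), of "C * D"]])
        (auto intro: le infsum_nonneg)
    thus "(\<lambda>z. norm (\<Sum>\<^sub>\<infinity>x. norm (case (z, x) of (z, x) \<Rightarrow> ?f z x))) summable_on UNIV"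
      by (simp add: infsum_nonneg)
  qed
  from infsum_swap_banach[OF abs_summable_summable[OF this]] show ?thesis ..
qed

text \<open>\<open>\<phi>\<close> is prescribed on \<open>uroe\<close> only, since its values at
  other matrices carry no meaning. \<open>w\<close> and \<open>Z\<close> name the Boltzmann weight
  and the partition function.\<close>

locale gibbs_functional =
  fixes h :: "'a::metric_space \<Rightarrow> real" and \<beta> :: real and \<phi> :: "'a mat \<Rightarrow> complex"
    and w :: "'a \<Rightarrow> real" and Z :: real
  assumes w_def: "w x = exp (- \<beta> * h x)"
    and Z_def: "Z = (\<Sum>\<^sub>\<infinity>x. w x)"
    and summable: "w summable_on UNIV"
    and gibbs: "a \<in> uroe \<Longrightarrow> \<phi> a = (1 / complex_of_real Z) * (\<Sum>\<^sub>\<infinity>x. a x x * complex_of_real (w x))"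
begin

lemma w_pos: "w x > 0"
  by (simp add: w_def)

lemma w_nonneg: "w x \<ge> 0"
  by (simp add: w_def)

lemma Z_pos: "Z > 0"
proof -
  fix x
  have "w x \<le> Z"
    using finite_sum_le_infsum[OF summable, of "{x}"] w_nonneg by (simp add: Z_def)
  thus ?thesis using w_pos[of x] by linarith
qed

lemmas diag_summable = diagonal_summable(2)[OF uroe_form_bound w_nonneg summable]

text \<open>The diagonal entries of \<open>mat_mult (mat_adj a) a\<close> are sums of squared moduli
  down a column of \<open>a\<close>, and the weights are nonnegative. The complex order used here
  records realness and nonnegativity at once.\<close>

lemma positive:
  assumes "a \<in> uroe" shows "\<phi> (mat_mult (mat_adj a) a) \<ge> 0"
proof -
  have mem: "mat_mult (mat_adj a) a \<in> uroe" using assms by (intro uroe_mult uroe_adj)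
  have "mat_mult (mat_adj a) a x x \<ge> 0" for x
  proof -
    have "mat_mult (mat_adj a) a x x = (\<Sum>\<^sub>\<infinity>z. mat_adj a x z * a z x)"
      by (simp add: mat_mult_def)
    also have "\<dots> \<ge> 0"
    proof (rule infsum_nonneg_complex)
      show "(\<lambda>z. mat_adj a x z * a z x) summable_on UNIV"
        by (rule has_sum_imp_summable[OF mat_mult_has_sum[OF uroe_form_bound[OF uroe_adj[OF assms]] uroe_form_bound[OF assms]]])
      show "mat_adj a x z * a z x \<ge> 0" for z
        by (simp add: mat_adj_def mult.commute[of "cnj _"] less_eq_complex_def flip: complex_norm_square)
    qed
    finally show ?thesis .
  qed
  hence "(\<Sum>\<^sub>\<infinity>x. mat_mult (mat_adj a) a x x * complex_of_real (w x)) \<ge> 0"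
    using w_nonneg by (intro infsum_nonneg_complex diag_summable mem) (auto simp: less_eq_complex_def)
  thus ?thesis
    unfolding gibbs[OF mem] using Z_pos by (auto simp: less_eq_complex_def)
qed

lemma state: "is_state \<phi>"
  unfolding is_state_def
proof (intro conjI ballI allI)
  show "\<phi> (mat_add a b) = \<phi> a + \<phi> b" if "a \<in> uroe" "b \<in> uroe" for a b
    using infsum_add[OF diag_summable[OF that(1)] diag_summable[OF that(2)]]
    unfolding gibbs[OF that(1)] gibbs[OF that(2)] gibbs[OF uroe_add[OF that]]
    by (simp add: mat_add_def algebra_simps add_divide_distrib)
  show "\<phi> (mat_smul c a) = c * \<phi> a" if "a \<in> uroe" for a c
    unfolding gibbs[OF that] gibbs[OF uroe_smul[OF that]]
    by (simp add: mat_smul_def mult.assoc infsum_cmult_right')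
  show "Im (\<phi> (mat_mult (mat_adj a) a)) = 0" "0 \<le> Re (\<phi> (mat_mult (mat_adj a) a))" if "a \<in> uroe" for a
    using positive[OF that] by (auto simp: less_eq_complex_def)
  have "(\<Sum>\<^sub>\<infinity>x. complex_of_real (w x)) = complex_of_real Z"
    unfolding Z_def by (rule infsumI[OF has_sum_of_real[OF has_sum_infsum[OF summable]]])
  thus "\<phi> mat_id = 1"
    unfolding gibbs[OF uroe_id] using Z_pos by (simp add: mat_id_def)
qed

lemma KMS: "is_KMS h \<beta> \<phi>"
  unfolding is_KMS_def
proof (intro conjI ballI allI impI state)
  fix a b :: "'a mat" and F
  assume a: "a \<in> uroe" and b: "b \<in> uroe" and F: "analytic_ext h b F"
  let ?F = "F (\<i> * of_real \<beta>)"
  have Fu: "?F \<in> uroe" using F unfolding analytic_ext_def op_entire_def by blast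
  \<comment> \<open>At \<open>\<i> * \<beta>\<close> the analytic extension contributes exactly the
    ratio \<open>w z / w x\<close>, which moves the weight from the column index to the row index of
    \<open>b\<close>.\<close>
  have wF: "?F z x * of_real (w x) = b z x * of_real (w z)" for z x
  proof -
    have "\<i> * (\<i> * of_real \<beta>) * complex_of_real (h z - h x) = of_real (- \<beta> * (h z - h x))"
      by (simp flip: mult.assoc)
    hence "?F z x = of_real (exp (- \<beta> * (h z - h x))) * b z x"
      unfolding analytic_ext_entry[OF F] by (simp only: exp_of_real)
    moreover have "exp (- \<beta> * (h z - h x)) * w x = w z"
      unfolding w_def exp_add[symmetric] by (simp add: algebra_simps)
    hence "of_real (exp (- \<beta> * (h z - h x))) * complex_of_real (w x) = of_real (w z)"
      by (metis of_real_mult)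
    ultimately show ?thesis by (simp add: mult_ac)
  qed
  have "(\<Sum>\<^sub>\<infinity>x. mat_mult a ?F x x * complex_of_real (w x))
      = (\<Sum>\<^sub>\<infinity>x. \<Sum>\<^sub>\<infinity>z. a x z * b z x * complex_of_real (w z))"
    unfolding mat_mult_def by (simp add: mult.assoc wF flip: infsum_cmult_left')
  also have "\<dots> = (\<Sum>\<^sub>\<infinity>z. \<Sum>\<^sub>\<infinity>x. a x z * b z x * complex_of_real (w z))"
    by (rule weighted_trace_swap[OF uroe_form_bound[OF a] uroe_form_bound[OF b] w_nonneg summable])
  also have "\<dots> = (\<Sum>\<^sub>\<infinity>z. mat_mult b a z z * complex_of_real (w z))"
    unfolding mat_mult_def infsum_cmult_left' by (simp add: mult.commute)
  finally show "\<phi> (mat_mult a ?F) = \<phi> (mat_mult b a)"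
    by (simp add: gibbs uroe_mult a b Fu)
qed

text \<open>On \<open>A\<close> the diagonal entries differ by at most \<open>\<delta>\<close>; off
  \<open>A\<close> they differ by at most \<open>2 * M\<close>, but carry only the total weight
  \<open>Z - sum w A\<close>. Dividing by \<open>Z\<close> turns \<open>\<delta> * Z\<close> into
  \<open>\<delta>\<close>.\<close>

lemma small_difference:
  assumes "a \<in> uroe" "b \<in> uroe" "opnorm a \<le> M" "opnorm b \<le> M" "finite A"
    and "\<And>x. x \<in> A \<Longrightarrow> cmod (b x x - a x x) \<le> \<delta>" "\<delta> \<ge> 0"
  shows "cmod (\<phi> b - \<phi> a) \<le> \<delta> + 2 * M * (Z - sum w A) / Z"
proof -
  have M: "M \<ge> 0" using form_bound_nonneg[OF uroe_form_bound[OF assms(1)]] assms(3) by linarith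
  let ?c = "mat_sub b a" and ?t = "\<lambda>x. if x \<in> A then 0 else w x"
  have c: "form_bound (2 * M) ?c"
    using form_bound_mono[OF form_bound_sub[OF uroe_form_bound uroe_form_bound], OF assms(2,1)] assms(3,4)
    by simp
  have t: "(?t has_sum (Z - sum w A)) UNIV"
  proof -
    have "(w has_sum (Z - sum w A)) (UNIV - A)"
      using summable assms(5) unfolding Z_def by (intro has_sum_Diff has_sum_infsum has_sum_finite) auto
    thus ?thesis by (subst has_sum_cong_neutral[where T = "UNIV - A" and g = w]) auto
  qed
  have bound: "((\<lambda>x. \<delta> * w x + 2 * M * ?t x) has_sum (\<delta> * Z + 2 * M * (Z - sum w A))) UNIV"
    using has_sum_infsum[OF summable] unfolding Z_def[symmetric]
    by (intro has_sum_add has_sum_cmult_right t)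
  have s: "(\<lambda>x. cmod (?c x x * complex_of_real (w x))) summable_on UNIV"
    by (rule diagonal_summable(1)[OF c w_nonneg summable])
  have "\<phi> b - \<phi> a = (1 / complex_of_real Z) * (\<Sum>\<^sub>\<infinity>x. ?c x x * complex_of_real (w x))"
  proof -
    have "\<phi> b - \<phi> a = \<phi> ?c"
      using state assms(1,2) uroe_smul[OF assms(1), of "-1"] unfolding is_state_def mat_sub_eq by simp
    also have "?c \<in> uroe"
      unfolding mat_sub_eq by (intro uroe_add uroe_smul assms)
    hence "\<phi> ?c = (1 / complex_of_real Z) * (\<Sum>\<^sub>\<infinity>x. ?c x x * complex_of_real (w x))"
      by (rule gibbs)
    finally show ?thesis .
  qed
  hence "cmod (\<phi> b - \<phi> a) = cmod (\<Sum>\<^sub>\<infinity>x. ?c x x * complex_of_real (w x)) / Z"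
    using Z_pos by (simp add: norm_mult norm_divide)
  also have "cmod (\<Sum>\<^sub>\<infinity>x. ?c x x * complex_of_real (w x)) \<le> (\<Sum>\<^sub>\<infinity>x. cmod (?c x x * complex_of_real (w x)))"
    by (rule norm_infsum_bound[OF s])
  also have "\<dots> \<le> (\<Sum>\<^sub>\<infinity>x. \<delta> * w x + 2 * M * ?t x)"
  proof (rule infsum_mono[OF s has_sum_imp_summable[OF bound]])
    fix x
    have "cmod (?c x x * complex_of_real (w x)) = cmod (?c x x) * w x"
      using w_nonneg[of x] by (simp add: norm_mult)
    \<comment> \<open>Keeping \<open>\<delta>\<close> off \<open>A\<close> as well costs nothing
      since \<open>\<delta> \<ge> 0\<close>, and gives one majorant with an explicit sum.\<close>
    also have "\<dots> \<le> (\<delta> + 2 * M * (if x \<in> A then 0 else 1)) * w x"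
      using assms(6)[of x] form_bound_entry[OF c, of x x] assms(7) M
      by (intro mult_right_mono w_nonneg) (auto simp: mat_sub_def)
    finally show "cmod (?c x x * complex_of_real (w x)) \<le> \<delta> * w x + 2 * M * ?t x"
      by (auto simp: algebra_simps)
  qed
  also have "\<dots> = \<delta> * Z + 2 * M * (Z - sum w A)"
    by (rule infsumI[OF bound])
  finally show ?thesis using Z_pos by (simp add: divide_right_mono field_simps)
qed

lemma strong_continuity: "strongly_continuous \<phi>"
  unfolding strongly_continuous_def
proof (intro allI impI ballI)
  fix B :: "'a mat set" and a and e :: real
  assume B: "B \<subseteq> uroe" "\<exists>M. \<forall>b\<in>B. opnorm b \<le> M" and a: "a \<in> B" and e: "e > 0"
  then obtain M where M: "\<And>b. b \<in> B \<Longrightarrow> opnorm b \<le> M" by blast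
  \<comment> \<open>The finite set \<open>A\<close> is chosen before the neighbourhood: its tail
    must cost less than \<open>e / 2\<close>, leaving the other half for the entries on
    \<open>A\<close>.\<close>
  have "((\<lambda>A. e / 2 + 2 * M * (Z - sum w A) / Z) \<longlongrightarrow> e / 2 + 2 * M * (Z - Z) / Z) (finite_subsets_at_top UNIV)"
    using infsum_tendsto[OF summable] Z_pos unfolding Z_def[symmetric]
    by (intro tendsto_intros) auto
  from order_tendstoD(2)[OF this, of e]
  have "\<forall>\<^sub>F A in finite_subsets_at_top UNIV. e / 2 + 2 * M * (Z - sum w A) / Z < e"
    using e by simp
  then obtain A where A: "finite A" "e / 2 + 2 * M * (Z - sum w A) / Z < e"
    unfolding eventually_finite_subsets_at_top by blast
  define d :: "'a \<Rightarrow> 'a \<Rightarrow> complex" where "d x = (\<lambda>y. if y = x then 1 else 0)" for x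
  have ell2_d: "ell2 (d x)" for x
    by (rule ell2_finite_support(1)[of "{x}"]) (auto simp: d_def)
  show "\<exists>V \<delta>. finite V \<and> (\<forall>\<xi>\<in>V. ell2 \<xi>) \<and> \<delta> > 0 \<and>
      (\<forall>b\<in>B. (\<forall>\<xi>\<in>V. ell2_norm (mat_app (mat_sub b a) \<xi>) < \<delta>) \<longrightarrow> cmod (\<phi> b - \<phi> a) < e)"
  \<comment> \<open>The test vectors are the basis vectors at the points of \<open>A\<close>: the
    image of such a vector is a column, whose norm dominates its diagonal entry.\<close>
  proof (intro exI[of _ "d ` A"] exI[of _ "e / 2"] conjI ballI impI)
    fix b assume b: "b \<in> B" and close: "\<forall>\<xi>\<in>d ` A. ell2_norm (mat_app (mat_sub b a) \<xi>) < e / 2"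
    have "cmod (b x x - a x x) \<le> e / 2" if "x \<in> A" for x
    proof -
      let ?c = "mat_sub b a"
      have col: "mat_app ?c (d x) = (\<lambda>u. ?c u x)"
      proof
        fix u
        have "((\<lambda>y. ?c u y * d x y) has_sum ?c u x) UNIV"
          by (rule has_sum_finite_neutralI[of "{x}"]) (auto simp: d_def)
        thus "mat_app ?c (d x) u = ?c u x" unfolding mat_app_def by (rule infsumI)
      qed
      have "form_bound (opnorm b + opnorm a) ?c"
        using a b B(1) by (intro form_bound_sub uroe_form_bound) auto
      hence "ell2 (\<lambda>u. ?c u x)" by (rule form_bound_col)
      from l2_on_le_ell2_norm[OF this, of "{x}"]
      have "cmod (?c x x) \<le> ell2_norm (mat_app ?c (d x))" by (simp add: col)
      also have "\<dots> \<le> e / 2" using close that by auto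
      finally show ?thesis by (simp add: mat_sub_def)
    qed
    hence "cmod (\<phi> b - \<phi> a) \<le> e / 2 + 2 * M * (Z - sum w A) / Z"
      using a b B(1) M A(1) e by (intro small_difference) auto
    thus "cmod (\<phi> b - \<phi> a) < e" using A(2) by linarith
  qed (use A(1) e ell2_d in auto)
qed

end

section \<open>Existence, characterisation and uniqueness of strongly continuous KMS states\<close>

theorem theorem1p6:
  fixes h :: "'a::metric_space \<Rightarrow> real" and \<beta> :: real
  assumes "ulf TYPE('a)" and "coarse h" and "\<beta> \<ge> 0"
  shows "((\<exists>\<phi>. is_KMS h \<beta> \<phi> \<and> strongly_continuous \<phi>)
           \<longleftrightarrow> (\<lambda>x. exp (- \<beta> * h x)) summable_on UNIV)
       \<and> ((\<lambda>x. exp (- \<beta> * h x)) summable_on UNIV \<longrightarrow>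
           (\<forall>\<phi>. (is_KMS h \<beta> \<phi> \<and> strongly_continuous \<phi>) \<longleftrightarrow>
             (\<forall>a\<in>uroe. \<phi> a = (1 / complex_of_real (\<Sum>\<^sub>\<infinity>x. exp (- \<beta> * h x)))
                              * (\<Sum>\<^sub>\<infinity>x. a x x * complex_of_real (exp (- \<beta> * h x))))))
       \<and> (\<forall>\<phi> \<psi>. is_KMS h \<beta> \<phi> \<and> strongly_continuous \<phi> \<and> is_KMS h \<beta> \<psi> \<and> strongly_continuous \<psi>
           \<longrightarrow> (\<forall>a\<in>uroe. \<phi> a = \<psi> a))"
proof -
  let ?w = "\<lambda>x. exp (- \<beta> * h x)"
  let ?G = "\<lambda>a. (1 / complex_of_real (\<Sum>\<^sub>\<infinity>x. ?w x)) * (\<Sum>\<^sub>\<infinity>x. a x x * complex_of_real (?w x))"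
  have conv: "is_KMS h \<beta> \<phi> \<and> strongly_continuous \<phi>"
    if "?w summable_on UNIV" "\<forall>a\<in>uroe. \<phi> a = ?G a" for \<phi>
  proof -
    interpret gibbs_functional h \<beta> \<phi> ?w "\<Sum>\<^sub>\<infinity>x. ?w x"
      by unfold_locales (use that in auto)
    show ?thesis using KMS strong_continuity by blast
  qed
  \<comment> \<open>The Gibbs formula, taken as a function on all matrices, is the witness.\<close>
  have ex: "\<exists>\<phi>. is_KMS h \<beta> \<phi> \<and> strongly_continuous \<phi>" if "?w summable_on UNIV"
    using conv[OF that, of ?G] by blast
  show ?thesis
  proof (intro conjI impI allI iffI)
    show "?w summable_on UNIV" if "\<exists>\<phi>. is_KMS h \<beta> \<phi> \<and> strongly_continuous \<phi>"
      using that KMS_gibbs(1) by blast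
    show "\<exists>\<phi>. is_KMS h \<beta> \<phi> \<and> strongly_continuous \<phi>" if "?w summable_on UNIV"
      by (rule ex[OF that])
    show "\<forall>a\<in>uroe. \<phi> a = ?G a" if "is_KMS h \<beta> \<phi> \<and> strongly_continuous \<phi>" for \<phi>
      using that KMS_gibbs(2) by blast
    show "is_KMS h \<beta> \<phi>" "strongly_continuous \<phi>"
      if "?w summable_on UNIV" "\<forall>a\<in>uroe. \<phi> a = ?G a" for \<phi>
      using conv[OF that] by auto
    show "\<forall>a\<in>uroe. \<phi> a = \<psi> a"
      if "is_KMS h \<beta> \<phi> \<and> strongly_continuous \<phi> \<and> is_KMS h \<beta> \<psi> \<and> strongly_continuous \<psi>" for \<phi> \<psi>
      using that KMS_gibbs(2)[of h \<beta> \<phi>] KMS_gibbs(2)[of h \<beta> \<psi>] by simp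
  qed
qed

end
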